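(* The blowup threshold is not monotone under taking induced subgraphs; that is, there exist graphs $H_1$ and $H_2$ such that $H_1$ is an induced subgraph of $H_2$ and $\delta_{\mathrm{B}}(H_1)>\delta_{\mathrm{B}}(H_2)$.
   Context: All graphs are finite and simple; $\delta(G)$ is the minimum degree of $G$. A graph $G$ is $H$-free if it contains no (not necessarily induced) subgraph isomorphic to $H$; it is maximal $H$-free if it is $H$-free and adding any missing edge on the same vertex set creates a copy of $H$. A blowup of a graph $F$ is obtained by replacing every vertex of $F$ by an independent set (possibly empty) and every edge of $F$ by a complete bipartite graph between the corresponding sets, with no other edges; $G=F[\cdot]$ means that $G$ is some blowup of $F$. The blowup threshold of $H$ is $$\delta_{\mathrm{B}}(H):=\inf\{\alpha\ge 0:\ \exists\,F=F(\alpha,H)\text{ such that every maximal }H\text{-free graph }G\text{ with }\delta(G)\ge\alpha|V(G)|\text{ satisfies }G=F[\cdot]\},$$ where $F$ is a (finite) graph. *)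

theory Defs
  imports Complex_Main "Graph_Theory.Graph_Theory"
begin

text \<open>
  A finite simple graph is a \<open>pair_graph\<close>: an undirected edge \<open>uv\<close> is represented by the two
  arcs \<open>(u,v)\<close> and \<open>(v,u)\<close>.  The null graph (no vertices) is allowed.
\<close>

definition contains_copy :: "'a pair_pre_digraph \<Rightarrow> 'b pair_pre_digraph \<Rightarrow> bool" where
  "contains_copy G H \<longleftrightarrow>
     (\<exists>K. subgraph (with_proj K) (with_proj G) \<and> digraph_iso (with_proj K) (with_proj H))"

definition add_edge :: "'a pair_pre_digraph \<Rightarrow> 'a \<Rightarrow> 'a \<Rightarrow> 'a pair_pre_digraph" where
  "add_edge G u v = G\<lparr>parcs := parcs G \<union> {(u, v), (v, u)}\<rparr>"

definition maximal_free :: "'b pair_pre_digraph \<Rightarrow> 'a pair_pre_digraph \<Rightarrow> bool" where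
  "maximal_free H G \<longleftrightarrow> \<not> contains_copy G H \<and>
     (\<forall>u\<in>pverts G. \<forall>v\<in>pverts G. u \<noteq> v \<and> (u, v) \<notin> parcs G \<longrightarrow> contains_copy (add_edge G u v) H)"

text \<open>
  In a symmetric digraph the degree of a vertex is its out-degree.  The value at the null graph is
  a convention without effect below: the null graph is a blowup of every graph.
\<close>

definition min_degree :: "'a pair_pre_digraph \<Rightarrow> nat" where
  "min_degree G =
     (if pverts G = {} then 0 else Min (out_degree (with_proj G) ` pverts G))"

text \<open>
  \<open>A x\<close> is the possibly empty independent set replacing the vertex \<open>x\<close> of \<open>F\<close>.  As the arc set of
  \<open>F\<close> is symmetric, \<open>A x \<times> A y\<close> and \<open>A y \<times> A x\<close> together give the complete bipartite graph
  replacing the edge \<open>xy\<close>.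
\<close>

definition is_blowup :: "'a pair_pre_digraph \<Rightarrow> 'b pair_pre_digraph \<Rightarrow> bool" where
  "is_blowup G F \<longleftrightarrow>
     (\<exists>A. (\<forall>x\<in>pverts F. \<forall>y\<in>pverts F. x \<noteq> y \<longrightarrow> A x \<inter> A y = {}) \<and>
          pverts G = (\<Union>x\<in>pverts F. A x) \<and>
          parcs G = (\<Union>(x, y)\<in>parcs F. A x \<times> A y))"

text \<open>
  Taking the vertices of \<open>F\<close> and \<open>G\<close> from \<open>nat\<close> is no restriction: every finite graph is
  isomorphic to one on natural numbers, and all notions involved are isomorphism invariant.
\<close>

definition blowup_admissible :: "'a pair_pre_digraph \<Rightarrow> real \<Rightarrow> bool" where
  "blowup_admissible H \<alpha> \<longleftrightarrow>
     (\<exists>F :: nat pair_pre_digraph. pair_graph F \<and>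
       (\<forall>G :: nat pair_pre_digraph.
          pair_graph G \<and> maximal_free H G \<and> real (min_degree G) \<ge> \<alpha> * real (card (pverts G))
          \<longrightarrow> is_blowup G F))"

definition blowup_threshold :: "'a pair_pre_digraph \<Rightarrow> real" where
  "blowup_threshold H = Inf {\<alpha>. \<alpha> \<ge> 0 \<and> blowup_admissible H \<alpha>}"

text \<open>The infimum is over a nonempty set of reals that is bounded below.\<close>

lemma min_degree_le_card:
  assumes "pair_graph G"
  shows "min_degree G \<le> card (pverts G)"
proof (cases "pverts G = {}")
  case False
  then obtain v where v: "v \<in> pverts G" by blast
  interpret pair_graph G by fact
  have fin: "finite (pverts G)" by (rule pair_finite_verts)
  have "min_degree G \<le> out_degree (with_proj G) v"
    using False v fin by (simp add: min_degree_def)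
  also have "\<dots> = card {e \<in> parcs G. fst e = v}"
    by (simp add: out_degree_def out_arcs_def)
  also have "\<dots> = card (snd ` {e \<in> parcs G. fst e = v})"
    by (rule card_image[symmetric]) (auto simp: inj_on_def)
  also have "\<dots> \<le> card (pverts G)"
    using fin by (intro card_mono) (auto dest: in_arcsD2)
  finally show ?thesis .
qed (simp add: min_degree_def)

lemma blowup_admissible_2: "blowup_admissible H 2"
proof -
  let ?F = "\<lparr>pverts = {}, parcs = {}\<rparr> :: nat pair_pre_digraph"
  have F: "pair_graph ?F"
    by unfold_locales (auto simp: symmetric_def sym_def)
  have "is_blowup G ?F"
    if G: "pair_graph G" and deg: "real (min_degree G) \<ge> 2 * real (card (pverts G))"
    for G :: "nat pair_pre_digraph"
  proof -
    interpret pair_graph G by fact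
    have "card (pverts G) = 0"
      using min_degree_le_card[OF G] deg by linarith
    then have "pverts G = {}" using pair_finite_verts by simp
    moreover from this have "parcs G = {}" by (auto dest: in_arcsD1)
    ultimately show ?thesis by (simp add: is_blowup_def)
  qed
  with F show ?thesis unfolding blowup_admissible_def by blast
qed

lemma blowup_threshold_set:
  "{\<alpha>. \<alpha> \<ge> 0 \<and> blowup_admissible H \<alpha>} \<noteq> {}"
  "bdd_below {\<alpha>. \<alpha> \<ge> 0 \<and> blowup_admissible H \<alpha>}"
  using blowup_admissible_2[of H] by (auto intro: exI[of _ 2] bdd_belowI[of _ 0])

end

theory Submission
  imports Defs
begin

text \<open>
  Let \<open>H\<^sub>1\<close> be the join of \<open>2K\<^sub>2\<close> and two isolated vertices, and let \<open>H\<^sub>2\<close> be the disjoint union of \<open>H\<^sub>1\<close>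
  and eight triangles.

  A large graph of minimum degree at least \<open>9n/20\<close> contains \<open>H\<^sub>2\<close> iff it contains ten disjoint
  triangles: each triangle has an edge with at least \<open>7n/60\<close> common neighbours, so two of the ten
  edges share two common neighbours outside the triangles. Hence a maximal \<open>H\<^sub>2\<close>-free graph \<open>G\<close> is also
  maximal without ten disjoint triangles. Removing a largest family of disjoint triangles leaves a
  triangle-free graph of minimum degree above \<open>2n/5\<close>, which is bipartite by Andrasfai's argument, and
  maximality makes this bipartite graph complete up to a bounded number of vertices. So \<open>G\<close> has boundedly
  many distinct neighbourhoods, and the threshold of \<open>H\<^sub>2\<close> is at most \<open>9/20\<close>.

  For \<open>H\<^sub>1\<close> there is an \<open>H\<^sub>1\<close>-free graph with minimum degree close to \<open>n/2\<close> that contains an induced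
  matching \<open>Al i - Be i\<close> such that in every \<open>H\<^sub>1\<close>-free supergraph the vertices \<open>Al i\<close> have
  distinct neighbourhoods. So its maximal \<open>H\<^sub>1\<close>-free supergraphs are no blowups of a fixed graph, and
  the threshold of \<open>H\<^sub>1\<close> is at least \<open>1/2\<close>.
\<close>

section \<open>Graphs, copies and blowups\<close>

text \<open>Vertex set and edge relation are separate parameters, so edges can be added and vertices
  removed without building records. The neighbourhood of a vertex is the relational image of its
  singleton.\<close>

locale sgraph =
  fixes V :: "'a set" and E :: "'a rel"
  assumes fin: "finite V" and sub: "E \<subseteq> V \<times> V" and symE: "sym E" and irr: "irrefl E"
begin

lemma edge_sym: "(x, y) \<in> E \<Longrightarrow> (y, x) \<in> E"
  using symE by (rule symD)

lemma edge_neq: "(x, y) \<in> E \<Longrightarrow> x \<noteq> y"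
  using irr by (auto simp: irrefl_def)

lemma edge_verts: "(x, y) \<in> E \<Longrightarrow> x \<in> V" "(x, y) \<in> E \<Longrightarrow> y \<in> V"
  using sub by auto

lemma nbr_sub: "E `` X \<subseteq> V"
  using sub by auto

lemma fin_nbr [simp]: "finite (E `` X)"
  using nbr_sub fin by (rule finite_subset)

end

lemma pair_graph_iff_sgraph: "pair_graph G \<longleftrightarrow> sgraph (pverts G) (parcs G)"
proof
  assume "pair_graph G"
  then interpret pair_graph G .
  show "sgraph (pverts G) (parcs G)"
    using pair_finite_verts in_arcsD1 in_arcsD2 pair_sym_arcs pair_no_loops
    by unfold_locales (fastforce simp: symmetric_def irrefl_def)+
next
  assume "sgraph (pverts G) (parcs G)"
  then interpret sgraph "pverts G" "parcs G" .
  have "finite (parcs G)"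
    using fin sub by (meson finite_SigmaI finite_subset)
  then show "pair_graph G"
    using fin sub symE irr by unfold_locales (auto simp: symmetric_def irrefl_def)
qed

section \<open>Copies as injective homomorphisms\<close>

definition embeds :: "'b pair_pre_digraph \<Rightarrow> 'a rel \<Rightarrow> 'a set \<Rightarrow> ('b \<Rightarrow> 'a) \<Rightarrow> bool" where
  "embeds H E V f \<longleftrightarrow> inj_on f (pverts H) \<and> f ` pverts H \<subseteq> V \<and>
     (\<forall>u v. (u, v) \<in> parcs H \<longrightarrow> (f u, f v) \<in> E)"

text \<open>An isomorphism from a subgraph \<open>K\<close> to \<open>H\<close> has an inverse on
  vertices, which embeds \<open>H\<close>; conversely the image of \<open>H\<close> under an
  embedding is such a \<open>K\<close>.\<close>

lemma contains_copy_iff: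
  fixes G :: "'a pair_pre_digraph" and H :: "'b pair_pre_digraph"
  assumes "pair_graph G" "pair_graph H"
  shows "contains_copy G H \<longleftrightarrow> (\<exists>f. embeds H (parcs G) (pverts G) f)"
proof
  interpret G: pair_graph G by fact
  interpret H: pair_graph H by fact
  assume "contains_copy G H"
  then obtain K where K: "subgraph (with_proj K) (with_proj G)"
    and iso: "digraph_iso (with_proj K) (with_proj H)"
    by (auto simp: contains_copy_def)
  from iso obtain h where h: "pre_digraph.digraph_isomorphism (with_proj K) h"
    and H: "with_proj H = app_iso h (with_proj K)"
    by (auto simp: digraph_iso_def)
  let ?g = "iso_verts h"
  have pv: "pverts H = ?g ` pverts K"
    using arg_cong[OF H, of verts] by simp
  have pa: "parcs H = iso_arcs h ` parcs K"
    using arg_cong[OF H, of arcs] by simp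
  \<comment> \<open>The equation \<open>H\<close> forces the end maps of \<open>h\<close> to be
    \<open>fst\<close> and \<open>snd\<close>, so \<open>h\<close> acts on an arc by acting on its
    two ends.\<close>
  have tl: "iso_tail h = fst" "iso_head h = snd"
    using arg_cong[OF H, of tail] arg_cong[OF H, of head] by simp_all
  have inj: "inj_on ?g (pverts K)"
    and arc: "\<And>a. a \<in> parcs K \<Longrightarrow> iso_arcs h a = (?g (fst a), ?g (snd a))"
    using h unfolding pre_digraph.digraph_isomorphism_def by (auto simp: tl prod_eq_iff)
  have sub: "pverts K \<subseteq> pverts G" "parcs K \<subseteq> parcs G" and wf: "wf_digraph (with_proj K)"
    using K by (auto simp: subgraph_def)
  have Kv: "fst a \<in> pverts K" "snd a \<in> pverts K" if "a \<in> parcs K" for a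
    using wf_digraph.tail_in_verts[OF wf] wf_digraph.head_in_verts[OF wf] that by auto
  define f where "f = the_inv_into (pverts K) ?g"
  have fg: "f (?g x) = x" if "x \<in> pverts K" for x
    using inj that by (simp add: f_def the_inv_into_f_f)
  have "embeds H (parcs G) (pverts G) f"
    unfolding embeds_def
  proof (intro conjI allI impI)
    show "inj_on f (pverts H)"
      by (auto simp: pv inj_on_def fg)
    show "f ` pverts H \<subseteq> pverts G"
      using sub by (auto simp: pv fg)
    show "(f u, f v) \<in> parcs G" if "(u, v) \<in> parcs H" for u v
    proof -
      obtain a where a: "a \<in> parcs K" "(u, v) = iso_arcs h a"
        using \<open>(u, v) \<in> parcs H\<close> pa by auto
      then have "u = ?g (fst a)" "v = ?g (snd a)"
        using arc by auto
      then have "(f u, f v) = a" using Kv a fg by simp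
      with a sub show ?thesis by auto
    qed
  qed
  then show "\<exists>f. embeds H (parcs G) (pverts G) f" by blast
next
  interpret G: pair_graph G by fact
  interpret H: pair_graph H by fact
  assume "\<exists>f. embeds H (parcs G) (pverts G) f"
  then obtain f where inj: "inj_on f (pverts H)" and v: "f ` pverts H \<subseteq> pverts G"
    and a: "\<And>u v. (u, v) \<in> parcs H \<Longrightarrow> (f u, f v) \<in> parcs G"
    by (auto simp: embeds_def)
  let ?K = "\<lparr>pverts = f ` pverts H, parcs = map_prod f f ` parcs H\<rparr>"
  let ?g = "the_inv_into (pverts H) f"
  let ?h = "\<lparr>iso_verts = ?g, iso_arcs = map_prod ?g ?g, iso_head = snd, iso_tail = fst\<rparr>"
  have wf: "wf_digraph (with_proj ?K)"
    by unfold_locales (auto dest: H.arc_fst_in_verts H.arc_snd_in_verts)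
  have gf: "?g (f x) = x" if "x \<in> pverts H" for x
    using inj that by (simp add: the_inv_into_f_f)
  have gf2: "map_prod ?g ?g (map_prod f f x) = x" if "x \<in> parcs H" for x
    using that H.arc_fst_in_verts[OF that] H.arc_snd_in_verts[OF that] by (cases x) (auto simp: gf)
  have "subgraph (with_proj ?K) (with_proj G)"
    using v a wf G.wf_digraph by (auto simp: subgraph_def compatible_def)
  moreover have "digraph_iso (with_proj ?K) (with_proj H)"
    unfolding digraph_iso_def
  proof (intro exI conjI)
    have "inj_on ?g (f ` pverts H)"
      by (auto simp: inj_on_def gf)
    moreover have "inj_on (map_prod ?g ?g) (map_prod f f ` parcs H)"
      by (rule inj_onI) (metis (no_types, lifting) gf2 imageE)
    ultimately show "pre_digraph.digraph_isomorphism (with_proj ?K) ?h"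
      using wf by (auto simp: pre_digraph.digraph_isomorphism_def)
    have "?g ` f ` pverts H = pverts H"
      by (auto simp: image_image gf)
    moreover have "map_prod ?g ?g ` map_prod f f ` parcs H = parcs H"
      unfolding image_image using gf2 by (simp del: map_prod_simp cong: image_cong)
    ultimately show "with_proj H = app_iso ?h (with_proj ?K)"
      by (simp add: app_iso_def with_proj_def)
  qed
  ultimately show "contains_copy G H"
    unfolding contains_copy_def by blast
qed

lemma add_edge_simps [simp]:
  "pverts (add_edge G u v) = pverts G"
  "parcs (add_edge G u v) = parcs G \<union> {(u, v), (v, u)}"
  by (simp_all add: add_edge_def)

lemma (in sgraph) sgraph_insert:
  assumes "u \<in> V" "v \<in> V" "u \<noteq> v"
  shows "sgraph V (E \<union> {(u, v), (v, u)})"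
  using assms fin sub symE irr by unfold_locales (auto simp: sym_def irrefl_def)

lemma out_degree_with_proj: "out_degree (with_proj G) v = card (parcs G `` {v})"
proof -
  have "parcs G `` {v} = snd ` {e \<in> parcs G. fst e = v}"
    by force
  moreover have "inj_on snd {e \<in> parcs G. fst e = v}"
    by (auto simp: inj_on_def)
  ultimately show ?thesis
    by (simp add: out_degree_def out_arcs_def card_image)
qed

lemma min_degree_le:
  assumes "pair_graph G" "v \<in> pverts G"
  shows "min_degree G \<le> card (parcs G `` {v})"
  using assms pair_fin_digraph.pair_finite_verts[of G]
  by (auto simp: min_degree_def out_degree_with_proj[symmetric] pair_graph_def pair_digraph_def
      intro!: Min_le)

lemma min_degree_ge:
  assumes "pair_graph G" "pverts G \<noteq> {}" "\<And>v. v \<in> pverts G \<Longrightarrow> d \<le> card (parcs G `` {v})"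
  shows "d \<le> min_degree G"
  using assms pair_fin_digraph.pair_finite_verts[of G]
  by (auto simp: min_degree_def out_degree_with_proj[symmetric] pair_graph_def pair_digraph_def
      intro!: Min.boundedI)

section \<open>Blowups and equal neighbourhoods\<close>

text \<open>Identifying vertices with equal neighbourhoods shows that such a graph is a blowup of a
  graph on \<open>{..<K}\<close>. \<open>F\<close> is the disjoint union of all graphs on
  \<open>{..<K}\<close>; since parts may be empty, it serves for all of them at once.\<close>

lemma universal_blowup:
  "\<exists>F :: nat pair_pre_digraph. pair_graph F \<and>
     (\<forall>G :: 'a pair_pre_digraph. pair_graph G \<and> card ((\<lambda>v. parcs G `` {v}) ` pverts G) \<le> K
        \<longrightarrow> is_blowup G F)"
proof -
  define RS where "RS = {R. R \<subseteq> {..<K} \<times> {..<K} \<and> sym R \<and> irrefl R}"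
  have "finite RS"
    by (rule finite_subset[of _ "Pow ({..<K} \<times> {..<K})"]) (auto simp: RS_def)
  then obtain idx :: "nat rel \<Rightarrow> nat" where idx: "inj_on idx RS"
    using finite_imp_inj_to_nat_seg by metis
  \<comment> \<open>The copy of \<open>x\<close> in the component \<open>R\<close>, coded as a
    natural number.\<close>
  define vx where "vx R x = prod_encode (idx R, x)" for R x
  have vx: "vx R x = vx R' y \<longleftrightarrow> R = R' \<and> x = y" if "R \<in> RS" "R' \<in> RS" for R R' x y
    using idx that by (auto simp: vx_def inj_on_def)
  define F where "F = \<lparr>pverts = (\<Union>R\<in>RS. vx R ` {..<K}), parcs = (\<Union>R\<in>RS. map_prod (vx R) (vx R) ` R)\<rparr>"
  have "pair_graph F"
    unfolding pair_graph_iff_sgraph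
  proof
    show "finite (pverts F)" using \<open>finite RS\<close> by (simp add: F_def)
    show "parcs F \<subseteq> pverts F \<times> pverts F"
    proof
      fix e assume "e \<in> parcs F"
      then obtain R x y where R: "R \<in> RS" "(x, y) \<in> R" "e = (vx R x, vx R y)"
        by (auto simp: F_def)
      then have "x < K" "y < K" by (auto simp: RS_def)
      with R show "e \<in> pverts F \<times> pverts F" by (auto simp: F_def)
    qed
    show "sym (parcs F)"
    proof (rule symI)
      fix u v assume "(u, v) \<in> parcs F"
      then obtain R x y where R: "R \<in> RS" "(x, y) \<in> R" "u = vx R x" "v = vx R y"
        by (auto simp: F_def)
      then have "(y, x) \<in> R" by (auto simp: RS_def dest: symD)
      with R show "(v, u) \<in> parcs F" by (force simp: F_def)
    qed
    have "(u, u) \<notin> parcs F" for u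
    proof
      assume "(u, u) \<in> parcs F"
      then obtain R x y where R: "R \<in> RS" "(x, y) \<in> R" "vx R x = vx R y"
        by (auto simp: F_def)
      then show False using vx[of R R x y] by (auto simp: RS_def irrefl_def)
    qed
    then show "irrefl (parcs F)" by (auto simp: irrefl_def)
  qed
  moreover have "is_blowup G F"
    if G: "pair_graph G" and K: "card ((\<lambda>v. parcs G `` {v}) ` pverts G) \<le> K" for G :: "'a pair_pre_digraph"
  proof -
    interpret sgraph "pverts G" "parcs G" using G by (simp add: pair_graph_iff_sgraph)
    let ?N = "\<lambda>v. parcs G `` {v}"
    obtain c where c: "bij_betw c (?N ` pverts G) {0..<card (?N ` pverts G)}"
      using ex_bij_betw_finite_nat[of "?N ` pverts G"] fin by blast
    define \<tau> where "\<tau> v = c (?N v)" for v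
    have \<tau>_lt: "\<tau> v < K" if "v \<in> pverts G" for v
    proof -
      have "c (?N v) \<in> {0..<card (?N ` pverts G)}"
        using bij_betw_apply[OF c] that by blast
      with K show ?thesis by (simp add: \<tau>_def)
    qed
    have \<tau>_eq: "?N u = ?N v" if "u \<in> pverts G" "v \<in> pverts G" "\<tau> u = \<tau> v" for u v
      using inj_onD[OF bij_betw_imp_inj_on[OF c], of "?N u" "?N v"] that by (simp add: \<tau>_def)
    define R where "R = map_prod \<tau> \<tau> ` parcs G"
    have "(\<tau> v, \<tau> u) \<in> R" if "(u, v) \<in> parcs G" for u v
      using edge_sym[OF that] by (force simp: R_def)
    moreover have "\<tau> u \<noteq> \<tau> v" if "(u, v) \<in> parcs G" for u v
      using \<tau>_eq[of u v] edge_verts[OF that] edge_neq[of v v] that by auto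
    ultimately have RS: "R \<in> RS"
      using \<tau>_lt edge_verts by (fastforce simp: RS_def sym_def irrefl_def R_def)
    \<comment> \<open>Adjacency depends only on the classes: the two ends of an edge are exchanged
      within their classes one at a time.\<close>
    have E: "(u, v) \<in> parcs G \<longleftrightarrow> (\<tau> u, \<tau> v) \<in> R" if uv: "u \<in> pverts G" "v \<in> pverts G" for u v
    proof
      assume "(\<tau> u, \<tau> v) \<in> R"
      then obtain u' v' where *: "(u', v') \<in> parcs G" "\<tau> u = \<tau> u'" "\<tau> v = \<tau> v'"
        by (auto simp: R_def)
      then have "(u, v') \<in> parcs G"
        using \<tau>_eq[of u u'] uv edge_verts by blast
      then have "u \<in> ?N v'" using edge_sym by blast
      then have "u \<in> ?N v" using \<tau>_eq[of v v'] uv edge_verts[OF *(1)] * by blast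
      then show "(u, v) \<in> parcs G" using edge_sym by blast
    qed (force simp: R_def)
    \<comment> \<open>Only the component \<open>R\<close> of \<open>F\<close> receives nonempty
      parts.\<close>
    let ?A = "\<lambda>z. {v \<in> pverts G. z = vx R (\<tau> v)}"
    show ?thesis
      unfolding is_blowup_def
    proof (intro exI conjI)
      show "\<forall>x\<in>pverts F. \<forall>y\<in>pverts F. x \<noteq> y \<longrightarrow> ?A x \<inter> ?A y = {}" by blast
      show "pverts G = (\<Union>x\<in>pverts F. ?A x)"
        using RS \<tau>_lt by (auto simp: F_def)
      show "parcs G = (\<Union>(x, y)\<in>parcs F. ?A x \<times> ?A y)"
      proof (intro equalityI subrelI)
        fix u v assume uv: "(u, v) \<in> parcs G"
        then have "(vx R (\<tau> u), vx R (\<tau> v)) \<in> parcs F"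
          using RS by (force simp: F_def R_def)
        then show "(u, v) \<in> (\<Union>(x, y)\<in>parcs F. ?A x \<times> ?A y)"
          using edge_verts[OF uv] by blast
      next
        fix u v assume "(u, v) \<in> (\<Union>(x, y)\<in>parcs F. ?A x \<times> ?A y)"
        then have uv: "u \<in> pverts G" "v \<in> pverts G" "(vx R (\<tau> u), vx R (\<tau> v)) \<in> parcs F" by auto
        then obtain R' x y where R': "R' \<in> RS" "(x, y) \<in> R'" "vx R (\<tau> u) = vx R' x" "vx R (\<tau> v) = vx R' y"
          by (auto simp: F_def)
        then have "(\<tau> u, \<tau> v) \<in> R" using vx RS by metis
        then show "(u, v) \<in> parcs G" using E uv by blast
      qed
    qed
  qed
  ultimately show ?thesis by blast
qed

text \<open>Vertices in the same part of a blowup have the same neighbourhood, and \<open>W\<close>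
  has more vertices than there are parts.\<close>

lemma blowup_twins:
  assumes F: "pair_graph F" and blow: "is_blowup G F"
    and W: "W \<subseteq> pverts G" "card (pverts F) < card W"
  shows "\<exists>u\<in>W. \<exists>v\<in>W. u \<noteq> v \<and> parcs G `` {u} = parcs G `` {v}"
proof -
  interpret F: sgraph "pverts F" "parcs F" using F by (simp add: pair_graph_iff_sgraph)
  obtain A where disj: "\<And>x y. x \<in> pverts F \<Longrightarrow> y \<in> pverts F \<Longrightarrow> x \<noteq> y \<Longrightarrow> A x \<inter> A y = {}"
    and V: "pverts G = (\<Union>x\<in>pverts F. A x)"
    and E: "parcs G = (\<Union>(x, y)\<in>parcs F. A x \<times> A y)"
    using blow unfolding is_blowup_def by metis
  have "\<forall>w\<in>W. \<exists>x\<in>pverts F. w \<in> A x" using V W by blast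
  then obtain p where p: "\<And>w. w \<in> W \<Longrightarrow> p w \<in> pverts F \<and> w \<in> A (p w)" by metis
  have "\<not> inj_on p W"
    using card_inj_on_le[of p W "pverts F"] p F.fin W by fastforce
  then obtain u v where uv: "u \<in> W" "v \<in> W" "u \<noteq> v" "p u = p v"
    by (auto simp: inj_on_def)
  have "parcs G `` {w} = (\<Union>y\<in>parcs F `` {p w}. A y)" if "w \<in> W" for w
  proof -
    have "x = p w" if "(x, y) \<in> parcs F" "w \<in> A x" for x y
      using disj[of x "p w"] p[OF \<open>w \<in> W\<close>] that F.edge_verts by blast
    then show ?thesis using p[OF that] unfolding E by fastforce
  qed
  then show ?thesis using uv by metis
qed

section \<open>The two forbidden graphs\<close>

text \<open>The edges between the triangles 012 and 345 that make both 0 and 3 adjacent to 1, 2, 4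
  and 5. Starting from two disjoint triangles lets a copy of \<open>H_tri k\<close> yield
  \<open>k\<close> disjoint triangles.\<close>

definition H_glue :: "nat rel" where
  "H_glue = {(0,4),(4,0),(0,5),(5,0),(3,1),(1,3),(3,2),(2,3)}"

lemma H_glue_sym: "(u, v) \<in> H_glue \<Longrightarrow> (v, u) \<in> H_glue"
  by (auto simp: H_glue_def)

lemma H_glue_less: "(u, v) \<in> H_glue \<Longrightarrow> u < 6" "(u, v) \<in> H_glue \<Longrightarrow> v < 6"
  by (auto simp: H_glue_def)

text \<open>
  The vertices \<open>0\<close> and \<open>3\<close> are joined to all four ends of the edges \<open>12\<close> and \<open>45\<close>: the graph
  \<open>H_tri 2\<close> is the join of \<open>2K\<^sub>2\<close> and two isolated vertices, and \<open>H_tri k\<close> is its disjoint union with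
  \<open>k - 2\<close> triangles.
\<close>

definition H_tri :: "nat \<Rightarrow> nat pair_pre_digraph" where
  "H_tri k = \<lparr>pverts = {..<3 * k},
     parcs = {(u, v). u < 3 * k \<and> v < 3 * k \<and> u \<noteq> v \<and> (u div 3 = v div 3 \<or> (u, v) \<in> H_glue)}\<rparr>"

lemma pair_graph_H_tri: "pair_graph (H_tri k)"
  unfolding pair_graph_iff_sgraph
  by unfold_locales (auto simp: H_tri_def sym_def irrefl_def H_glue_sym)

text \<open>\<open>k\<close> enters the adjacency condition only as a bound on the vertices, so the
  smaller graph is a restriction of the larger one.\<close>

lemma induced_subgraph_H_tri:
  assumes "j \<le> k"
  shows "induced_subgraph (with_proj (H_tri j)) (with_proj (H_tri k))"
proof -
  interpret j: pair_graph "H_tri j" by (rule pair_graph_H_tri)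
  interpret k: pair_graph "H_tri k" by (rule pair_graph_H_tri)
  show ?thesis
    using assms j.wf_digraph k.wf_digraph
    by (auto simp: induced_subgraph_def subgraph_def compatible_def H_tri_def)
qed

section \<open>Families of disjoint triangles\<close>

definition is_triangle :: "'a rel \<Rightarrow> 'a set \<Rightarrow> bool" where
  "is_triangle E T \<longleftrightarrow> card T = 3 \<and> (\<forall>x\<in>T. \<forall>y\<in>T. x \<noteq> y \<longrightarrow> (x, y) \<in> E)"

definition packing :: "'a rel \<Rightarrow> 'a set set \<Rightarrow> bool" where
  "packing E \<T> \<longleftrightarrow> finite \<T> \<and> (\<forall>T\<in>\<T>. is_triangle E T) \<and> pairwise disjnt \<T>"

lemma triangle_finite: "is_triangle E T \<Longrightarrow> finite T"
  using card_ge_0_finite[of T] by (simp add: is_triangle_def)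

lemma packing_card: "packing E \<T> \<Longrightarrow> card (\<Union>\<T>) = 3 * card \<T>"
proof -
  assume p: "packing E \<T>"
  then have "card (\<Union>\<T>) = (\<Sum>T\<in>\<T>. card T)"
    by (intro card_Union_disjoint) (auto simp: packing_def dest: triangle_finite)
  also have "\<dots> = (\<Sum>T\<in>\<T>. 3)"
    using p by (intro sum.cong) (auto simp: packing_def is_triangle_def)
  finally show ?thesis by simp
qed

lemma packing_finite_Union: "packing E \<T> \<Longrightarrow> finite (\<Union>\<T>)"
  by (auto simp: packing_def dest: triangle_finite)

lemma packing_subset: "packing E \<T> \<Longrightarrow> \<S> \<subseteq> \<T> \<Longrightarrow> packing E \<S>"
  by (auto simp: packing_def intro: finite_subset pairwise_subset)

lemma packing_insert:
  assumes "packing E \<T>" "is_triangle E T" "T \<inter> \<Union>\<T> = {}"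
  shows "packing E (insert T \<T>)" "card (insert T \<T>) = Suc (card \<T>)"
proof -
  show "packing E (insert T \<T>)"
    using assms by (auto simp: packing_def pairwise_insert disjnt_def)
  have "T \<noteq> {}" using assms by (auto simp: is_triangle_def)
  then have "T \<notin> \<T>" using assms by blast
  then show "card (insert T \<T>) = Suc (card \<T>)"
    using assms by (simp add: packing_def)
qed

lemma (in sgraph) triangle_insertI:
  assumes "(x, y) \<in> E" "(y, z) \<in> E" "(x, z) \<in> E"
  shows "is_triangle E {x, y, z}"
  using assms assms[THEN edge_neq] assms[THEN edge_sym] by (auto simp: is_triangle_def)

lemma (in sgraph) triangle_subset_verts: "is_triangle E T \<Longrightarrow> T \<subseteq> V"
proof
  fix x assume T: "is_triangle E T" and x: "x \<in> T"
  have "T \<noteq> {x}" using T by (auto simp: is_triangle_def)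
  with x obtain y where "y \<in> T" "y \<noteq> x" by blast
  with T x have "(x, y) \<in> E" by (auto simp: is_triangle_def)
  then show "x \<in> V" by (rule edge_verts)
qed

text \<open>Each block of three consecutive vertices starting at \<open>3 * i\<close> is a triangle
  of \<open>H_tri k\<close>. This is applied to a graph with one edge added.\<close>

lemma packing_of_embeds:
  assumes "embeds (H_tri k) E V f"
  shows "\<exists>\<T>. packing E \<T> \<and> card \<T> = k"
proof -
  define C :: "nat \<Rightarrow> nat set" where "C i = {3 * i, 3 * i + 1, 3 * i + 2}" for i
  have inj: "inj_on f {..<3 * k}" and arc: "\<And>u v. (u, v) \<in> parcs (H_tri k) \<Longrightarrow> (f u, f v) \<in> E"
    using assms by (auto simp: embeds_def H_tri_def)
  have C_div: "u div 3 = i" if "u \<in> C i" for u i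
    using that by (auto simp: C_def)
  have C: "C i \<subseteq> {..<3 * k}" if "i < k" for i
    using that by (auto simp: C_def)
  have disj: "f ` C i \<inter> f ` C j = {}" if "i < k" "j < k" "i \<noteq> j" for i j
  proof -
    have "C i \<inter> C j = {}" using that C_div by blast
    then show ?thesis
      using inj_on_image_Int[OF inj C C] that by (metis image_empty)
  qed
  have tri: "is_triangle E (f ` C i)" if "i < k" for i
    unfolding is_triangle_def
  proof (intro conjI ballI impI)
    have "card (f ` C i) = card (C i)"
      using inj_on_subset[OF inj C[OF that]] by (rule card_image)
    then show "card (f ` C i) = 3" by (simp add: C_def)
    fix x y assume "x \<in> f ` C i" "y \<in> f ` C i" "x \<noteq> y"
    then obtain u v where uv: "u \<in> C i" "v \<in> C i" "x = f u" "y = f v" "u \<noteq> v" by blast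
    then have "(u, v) \<in> parcs (H_tri k)"
      using C[OF that] C_div by (auto simp: H_tri_def)
    then show "(x, y) \<in> E" using arc uv by blast
  qed
  have "packing E ((\<lambda>i. f ` C i) ` {..<k})"
    unfolding packing_def
  proof (intro conjI ballI pairwiseI)
    fix S T assume "S \<in> (\<lambda>i. f ` C i) ` {..<k}" "T \<in> (\<lambda>i. f ` C i) ` {..<k}" "S \<noteq> T"
    then show "disjnt S T" using disj unfolding disjnt_def by blast
  qed (use tri in auto)
  moreover have "inj_on (\<lambda>i. f ` C i) {..<k}"
  proof (rule inj_onI)
    fix i j assume ij: "i \<in> {..<k}" "j \<in> {..<k}" "f ` C i = f ` C j"
    have "f ` C i \<noteq> {}" by (simp add: C_def)
    with ij show "i = j" using disj[of i j] by auto
  qed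
  then have "card ((\<lambda>i. f ` C i) ` {..<k}) = k" by (simp add: card_image)
  ultimately show ?thesis by blast
qed

text \<open>\<open>p\<close>, \<open>a\<close>, \<open>b\<close>, \<open>q\<close>,
  \<open>c\<close>, \<open>d\<close> become the vertices 0 to 5 in this order, which matches
  \<open>H_glue\<close>; the triangles of the packing become the later blocks.\<close>

lemma (in sgraph) embeds_H_tri:
  assumes pack: "packing E \<T>" and card: "card \<T> = r"
    and dist: "distinct [p, a, b, q, c, d]" and avoid: "{p, a, b, q, c, d} \<inter> \<Union>\<T> = {}"
    and edges: "(a, b) \<in> E" "(c, d) \<in> E" "{a, b, c, d} \<subseteq> E `` {p}" "{a, b, c, d} \<subseteq> E `` {q}"
  shows "\<exists>f. embeds (H_tri (r + 2)) E V f"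
proof -
  have "finite \<T>" using pack by (simp add: packing_def)
  then obtain h where h: "bij_betw h {0..<r} \<T>"
    using ex_bij_betw_nat_finite card by blast
  have "\<exists>e. bij_betw e {0..<3::nat} T" if "T \<in> \<T>" for T
  proof -
    have "card T = 3" using pack that by (auto simp: packing_def is_triangle_def)
    then show ?thesis
      using ex_bij_betw_nat_finite[of T] card_ge_0_finite[of T] by auto
  qed
  then obtain e where e: "\<And>T. T \<in> \<T> \<Longrightarrow> bij_betw (e T) {0..<3::nat} T" by metis
  let ?L = "[p, a, b, q, c, d]"
  \<comment> \<open>The shift by 2 accounts for the blocks 0 and 1, taken by the six named
    vertices.\<close>
  define f where "f u = (if u < 6 then ?L ! u else e (h (u div 3 - 2)) (u mod 3))" for u
  have hT: "h (u div 3 - 2) \<in> \<T>" if "u < 3 * (r + 2)" "\<not> u < 6" for u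
  proof -
    have "u div 3 - 2 < r" using that by presburger
    then show ?thesis using h by (auto simp: bij_betw_def)
  qed
  have fT: "f u \<in> h (u div 3 - 2)" if "u < 3 * (r + 2)" "\<not> u < 6" for u
    using that e[OF hT[OF that]] by (auto simp: f_def bij_betw_def)
  have fL: "f u \<in> {p, a, b, q, c, d}" if "u < 6" for u
    using nth_mem[of u ?L] that by (auto simp: f_def)
  have inj6: "f u = f v \<longleftrightarrow> u = v" if "u < 6" "v < 6" for u v
    using nth_eq_iff_index_eq[OF dist, of u v] that by (simp add: f_def)
  have inj: "u = v" if uv: "u < 3 * (r + 2)" "v < 3 * (r + 2)" and eq: "f u = f v" for u v
  proof (cases "u < 6 \<or> v < 6")
    case True
    then have "u < 6" "v < 6"
      using fL[of u] fL[of v] fT[of u] fT[of v] hT[of u] hT[of v] uv eq avoid by (metis UnionI disjoint_iff)+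
    then show ?thesis using inj6 eq by blast
  next
    case False
    have "h (u div 3 - 2) = h (v div 3 - 2)"
    proof (rule ccontr)
      assume "h (u div 3 - 2) \<noteq> h (v div 3 - 2)"
      then have "h (u div 3 - 2) \<inter> h (v div 3 - 2) = {}"
        using pack hT[of u] hT[of v] uv False by (auto simp: packing_def pairwise_def disjnt_def)
      then show False using fT[of u] fT[of v] uv False eq by auto
    qed
    moreover from this have "u div 3 - 2 = v div 3 - 2"
      using h uv False by (auto simp: bij_betw_def inj_on_def)
    ultimately have "u mod 3 = v mod 3"
      using e[OF hT[of u]] uv False eq by (auto simp: f_def bij_betw_def inj_on_def)
    \<comment> \<open>Truncated subtraction loses nothing here: both quotients are at least
      2.\<close>
    moreover have "u div 3 = v div 3"
      using \<open>u div 3 - 2 = v div 3 - 2\<close> False by linarith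
    ultimately show ?thesis by (metis div_mult_mod_eq)
  qed
  have six: "w < 6 \<longleftrightarrow> w div 3 < 2" for w :: nat by presburger
  have edges': "(a, b) \<in> E" "(c, d) \<in> E" "(p, a) \<in> E" "(p, b) \<in> E" "(p, c) \<in> E" "(p, d) \<in> E"
    "(q, a) \<in> E" "(q, b) \<in> E" "(q, c) \<in> E" "(q, d) \<in> E"
    using edges by auto
  have arc: "(f u, f v) \<in> E" if "(u, v) \<in> parcs (H_tri (r + 2))" for u v
  proof -
    have uv: "u < 3 * (r + 2)" "v < 3 * (r + 2)" "u \<noteq> v"
      and c: "u div 3 = v div 3 \<or> (u, v) \<in> H_glue"
      using that by (auto simp: H_tri_def)
    show ?thesis
    proof (cases "u < 6")
      case True
      have "v < 6"
        using c
      proof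
        assume *: "u div 3 = v div 3"
        with True six show ?thesis by simp
      qed (rule H_glue_less)
      have *: "w = 0 \<or> w = 1 \<or> w = 2 \<or> w = 3 \<or> w = 4 \<or> w = 5" if "w < 6" for w :: nat
        using that by linarith
      have f: "f 0 = p" "f 1 = a" "f (Suc 0) = a" "f 2 = b" "f 3 = q" "f 4 = c" "f 5 = d"
        by (simp_all add: f_def eval_nat_numeral)
      from *[OF True] *[OF \<open>v < 6\<close>] show ?thesis
        using c \<open>u \<noteq> v\<close>
        by (elim disjE; hypsubst_thin; simp add: f H_glue_def edges' edges'[THEN edge_sym])
    next
      case False
      with c have *: "u div 3 = v div 3" using H_glue_less by blast
      with False six have v: "\<not> v < 6" by simp
      have "f u \<noteq> f v" using inj uv by blast
      moreover have "is_triangle E (h (u div 3 - 2))"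
        using pack hT[of u] False uv by (auto simp: packing_def)
      ultimately show ?thesis
        using fT[of u] fT[of v] uv False v * by (auto simp: is_triangle_def)
    qed
  qed
  have "f u \<in> V" if "u < 3 * (r + 2)" for u
  proof (cases "u < 6")
    case True
    then show ?thesis using fL[OF True] edges edge_verts by auto
  next
    case False
    then show ?thesis
      using fT[of u] hT[of u] that pack triangle_subset_verts by (auto simp: packing_def)
  qed
  then have "embeds (H_tri (r + 2)) E V f"
    using inj arc by (auto simp: embeds_def H_tri_def inj_on_def)
  then show ?thesis by blast
qed

section \<open>The upper bound\<close>

text \<open>A new set overlaps the union of the previous ones in at most as many elements as there
  are previous sets, so multiple counting costs at most the square of the number of sets.\<close>

lemma sum_card_le_almost_disjoint:
  assumes "finite I" "finite V" "\<And>i. i \<in> I \<Longrightarrow> L i \<subseteq> V"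
    and "\<And>i j. i \<in> I \<Longrightarrow> j \<in> I \<Longrightarrow> i \<noteq> j \<Longrightarrow> card (L i \<inter> L j) \<le> 1"
  shows "(\<Sum>i\<in>I. card (L i)) \<le> card V + (card I)\<^sup>2"
proof -
  have "(\<Sum>i\<in>I. card (L i)) \<le> card (\<Union>i\<in>I. L i) + (card I)\<^sup>2"
    using assms
  proof (induction I)
    case (insert k I)
    let ?U = "\<Union>i\<in>I. L i"
    have fin: "finite (L k)" "finite ?U"
      using insert.prems insert.hyps by (meson finite_UN finite_subset insertCI)+
    have "card (?U \<inter> L k) = card (\<Union>i\<in>I. L i \<inter> L k)" by (rule arg_cong[of _ _ card]) blast
    also have "\<dots> \<le> (\<Sum>i\<in>I. card (L i \<inter> L k))" by (rule card_UN_le) fact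
    also have "\<dots> \<le> (\<Sum>i\<in>I. 1)" using insert by (intro sum_mono) (metis insertCI)
    finally have "card (?U \<inter> L k) \<le> card I" by simp
    moreover have "card ?U + card (L k) = card (?U \<union> L k) + card (?U \<inter> L k)"
      using fin by (intro card_Un_Int)
    moreover have "(\<Sum>i\<in>I. card (L i)) \<le> card ?U + (card I)\<^sup>2"
      using insert by simp
    ultimately show ?case
      using insert.hyps by (simp add: Un_commute power2_eq_square)
  qed simp
  also have "card (\<Union>i\<in>I. L i) \<le> card V"
    using assms by (intro card_mono) auto
  finally show ?thesis by simp
qed

section \<open>Graphs of large minimum degree\<close>

context sgraph
begin

text \<open>Turns cardinalities into sums of indicators, so that inequalities between them can be
  checked vertex by vertex.\<close>

lemma card_conv_sum: "X \<subseteq> V \<Longrightarrow> card X = (\<Sum>v\<in>V. if v \<in> X then 1 else 0)"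
  using fin by (simp add: sum.If_cases inf.absorb2)

text \<open>Let n be \<open>card V\<close>, fix \<open>u\<close>, and let \<open>A\<close> be the
  set of vertices sharing a neighbour with \<open>u\<close>. An edge inside \<open>A\<close> closes
  a walk of length five; each vertex is adjacent to at most two of its five positions, against
  degrees above 2n/5. An edge outside \<open>A\<close> gives three pairwise disjoint neighbourhoods,
  together larger than \<open>V\<close>.\<close>

lemma bipartite_if_triangle_free:
  assumes tf: "\<And>T. \<not> is_triangle E T"
    and deg: "\<And>v. v \<in> V \<Longrightarrow> 2 * card V < 5 * card (E `` {v})"
  obtains A B where "A \<union> B = V" "A \<inter> B = {}" "E \<inter> A \<times> A = {}" "E \<inter> B \<times> B = {}"
proof (cases "V = {}")
  case True
  then show ?thesis using that[of "{}" "{}"] by simp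
next
  case False
  then obtain u where u: "u \<in> V" by blast
  let ?N = "\<lambda>v. E `` {v}"
  have dis: "?N x \<inter> ?N y = {}" if "(x, y) \<in> E" for x y
    using tf triangle_insertI[OF that] by blast
  define A where "A = {x \<in> V. ?N u \<inter> ?N x \<noteq> {}}"
  have "(a, a') \<notin> E" if aA: "a \<in> A" "a' \<in> A" for a a'
  proof
    assume aa: "(a, a') \<in> E"
    obtain b b' where b: "(u, b) \<in> E" "(a, b) \<in> E" and b': "(u, b') \<in> E" "(a', b') \<in> E"
      using aA unfolding A_def by blast
    have V: "u \<in> V" "b \<in> V" "a \<in> V" "a' \<in> V" "b' \<in> V"
      using u b b' edge_verts by blast+
    let ?i = "\<lambda>x v. if v \<in> ?N x then 1 else (0::nat)"
    \<comment> \<open>Consecutive vertices of the closed walk u b a a' b' have disjoint neighbourhoods.\<close>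
    have "(\<Sum>v\<in>V. ?i u v + ?i b v + ?i a v + ?i a' v + ?i b' v) \<le> (\<Sum>v\<in>V. 2)"
    proof (rule sum_mono)
      fix v
      show "?i u v + ?i b v + ?i a v + ?i a' v + ?i b' v \<le> 2"
        using dis[OF b(1)] dis[OF b(2)] dis[OF aa] dis[OF b'(1)] dis[OF b'(2)]
        by (simp add: disjoint_iff)
    qed
    then have "card (?N u) + card (?N b) + card (?N a) + card (?N a') + card (?N b') \<le> 2 * card V"
      by (simp add: sum.distrib card_conv_sum[OF nbr_sub])
    then show False
      using V[THEN deg] by linarith
  qed
  moreover have "(y, y') \<notin> E" if "y \<in> V - A" "y' \<in> V - A" for y y'
  proof
    assume yy: "(y, y') \<in> E"
    have "card (?N u) + card (?N y) + card (?N y') = card (?N u \<union> ?N y \<union> ?N y')"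
      using dis[OF yy] that by (subst card_Un_disjoint; force simp: A_def card_Un_disjoint)+
    also have "\<dots> \<le> card V"
      using nbr_sub fin by (intro card_mono) auto
    finally show False
      using deg[OF u] deg[of y] deg[of y'] that by auto
  qed
  ultimately show ?thesis
    by (intro that[of A "V - A"]) (auto simp: A_def)
qed

lemma embeds_H_tri_of_packing:
  assumes n: "3000 \<le> card V" and deg: "\<And>v. v \<in> V \<Longrightarrow> 9 * card V \<le> 20 * card (E `` {v})"
    and pack: "packing E \<T>" "card \<T> = 10"
  shows "\<exists>f. embeds (H_tri 10) E V f"
proof -
  let ?N = "\<lambda>v. E `` {v}"
  have "\<exists>a b. a \<in> T \<and> b \<in> T \<and> (a, b) \<in> E \<and> 7 * card V \<le> 60 * card (?N a \<inter> ?N b)"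
    if "T \<in> \<T>" for T
  proof -
    have T: "is_triangle E T" using pack that by (simp add: packing_def)
    then obtain x y z where xyz: "T = {x, y, z}" "x \<noteq> y" "y \<noteq> z" "x \<noteq> z"
      by (auto simp: is_triangle_def card_3_iff)
    with T have E: "(x, y) \<in> E" "(y, z) \<in> E" "(x, z) \<in> E" by (auto simp: is_triangle_def)
    then have V: "x \<in> V" "y \<in> V" "z \<in> V" using edge_verts by blast+
    let ?i = "\<lambda>X v. if v \<in> X then 1 else (0::nat)"
    \<comment> \<open>A vertex in k of the three neighbourhoods lies in k choose 2 of the pairwise
      intersections, and k is at most one more than that. With n vertices the degrees add up to at
      least 27n/20, hence the intersections to at least 7n/20.\<close>
    have "(\<Sum>v\<in>V. ?i (?N x) v + ?i (?N y) v + ?i (?N z) v)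
      \<le> (\<Sum>v\<in>V. 1 + ?i (?N x \<inter> ?N y) v + ?i (?N y \<inter> ?N z) v + ?i (?N x \<inter> ?N z) v)"
      by (intro sum_mono) auto
    moreover have "card (?N x \<inter> ?N y) = (\<Sum>v\<in>V. ?i (?N x \<inter> ?N y) v)"
      "card (?N y \<inter> ?N z) = (\<Sum>v\<in>V. ?i (?N y \<inter> ?N z) v)"
      "card (?N x \<inter> ?N z) = (\<Sum>v\<in>V. ?i (?N x \<inter> ?N z) v)"
      using nbr_sub by (intro card_conv_sum; blast)+
    ultimately have "card (?N x) + card (?N y) + card (?N z)
      \<le> card V + card (?N x \<inter> ?N y) + card (?N y \<inter> ?N z) + card (?N x \<inter> ?N z)"
      by (simp only: sum.distrib card_conv_sum[OF nbr_sub, symmetric]) simp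
    then have "7 * card V \<le> 60 * card (?N x \<inter> ?N y) \<or> 7 * card V \<le> 60 * card (?N y \<inter> ?N z)
      \<or> 7 * card V \<le> 60 * card (?N x \<inter> ?N z)"
      using V[THEN deg] by linarith
    then show ?thesis using E xyz(1) by blast
  qed
  then obtain a b where ab: "\<And>T. T \<in> \<T> \<Longrightarrow> a T \<in> T \<and> b T \<in> T \<and> (a T, b T) \<in> E
      \<and> 7 * card V \<le> 60 * card (?N (a T) \<inter> ?N (b T))"
    by metis
  have fin\<T>: "finite \<T>" "finite (\<Union>\<T>)" "card (\<Union>\<T>) = 30"
    using pack packing_card[OF pack(1)] packing_finite_Union[OF pack(1)] by (auto simp: packing_def)
  define L where "L T = ?N (a T) \<inter> ?N (b T) - \<Union>\<T>" for T
  have L: "7 * card V \<le> 60 * card (L T) + 1800" if "T \<in> \<T>" for T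
  proof -
    have "card (?N (a T) \<inter> ?N (b T)) - card (\<Union>\<T>) \<le> card (L T)"
      unfolding L_def by (rule diff_card_le_card_Diff) (rule fin\<T>)
    with ab[OF that] fin\<T> show ?thesis by linarith
  qed
  \<comment> \<open>Otherwise ten almost disjoint sets of size at least 7n/60 - 30 would give 7n/6 -
    300 \<le> n + 100, which fails for n \<ge> 3000.\<close>
  have "\<exists>T\<in>\<T>. \<exists>T'\<in>\<T>. T \<noteq> T' \<and> 1 < card (L T \<inter> L T')"
  proof (rule ccontr)
    assume "\<not> ?thesis"
    then have "(\<Sum>T\<in>\<T>. card (L T)) \<le> card V + (card \<T>)\<^sup>2"
      using fin\<T> fin nbr_sub
      by (intro sum_card_le_almost_disjoint) (auto simp: L_def not_less dest: edge_verts)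
    moreover have "(\<Sum>T\<in>\<T>. 7 * card V) \<le> (\<Sum>T\<in>\<T>. 60 * card (L T) + 1800)"
      by (intro sum_mono L)
    ultimately show False
      using n pack by (simp add: sum.distrib sum_distrib_left[symmetric])
  qed
  then obtain T T' where TT: "T \<in> \<T>" "T' \<in> \<T>" "T \<noteq> T'" "1 < card (L T \<inter> L T')" by blast
  then obtain p q where pq: "p \<in> L T \<inter> L T'" "q \<in> L T \<inter> L T'" "p \<noteq> q"
    by (metis card_le_Suc0_iff_eq card.infinite leD not_less_eq One_nat_def zero_less_one less_imp_not_less)
  have disj: "T \<inter> T' = {}"
    using pack TT by (auto simp: packing_def pairwise_def disjnt_def)
  have other: "T \<inter> S = {} \<and> T' \<inter> S = {}" if "S \<in> \<T> - {T, T'}" for S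
    using pack TT that by (auto simp: packing_def pairwise_def disjnt_def)
  have edges: "(a T, b T) \<in> E" "(a T', b T') \<in> E" "{a T, b T, a T', b T'} \<subseteq> ?N p" "{a T, b T, a T', b T'} \<subseteq> ?N q"
    using ab[OF TT(1)] ab[OF TT(2)] pq edge_sym by (auto simp: L_def)
  \<comment> \<open>The third vertices of \<open>T\<close> and \<open>T'\<close> are dropped: the
    two chosen edges and \<open>p\<close>, \<open>q\<close> form the six-vertex component, and the
    other eight triangles remain.\<close>
  have "\<exists>f. embeds (H_tri (8 + 2)) E V f"
  proof (rule embeds_H_tri)
    show "packing E (\<T> - {T, T'})" using pack(1) by (rule packing_subset) blast
    show "card (\<T> - {T, T'}) = 8" using pack TT fin\<T> by (simp add: card_Diff_subset)
    have p: "p \<notin> \<Union>\<T>" "q \<notin> \<Union>\<T>" using pq by (auto simp: L_def)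
    have mem: "a T \<in> T" "b T \<in> T" "a T' \<in> T'" "b T' \<in> T'"
      using ab[OF TT(1)] ab[OF TT(2)] by blast+
    have disj': "x \<noteq> y" if "x \<in> T" "y \<in> T'" for x y
      using that disj by blast
    have pT: "x \<noteq> p" "x \<noteq> q" if "x \<in> T \<union> T'" for x
      using that p TT by blast+
    show "distinct [p, a T, b T, q, a T', b T']"
      using mem edges(1,2)[THEN edge_neq] pq(3) by (simp add: disj' pT pT[symmetric])
    have "(T \<union> T' \<union> {p, q}) \<inter> \<Union>(\<T> - {T, T'}) = {}"
      using p other by blast
    moreover have "{p, a T, b T, q, a T', b T'} \<subseteq> T \<union> T' \<union> {p, q}"
      using mem by simp
    ultimately show "{p, a T, b T, q, a T', b T'} \<inter> \<Union>(\<T> - {T, T'}) = {}"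
      by (meson disjoint_iff subsetD)
  qed (rule edges)+
  then show ?thesis by simp
qed

text \<open>\<open>W\<close> will be the set covered by nine other triangles. With n vertices, a
  neighbour \<open>a\<close> of \<open>x\<close> in \<open>A\<close> outside \<open>W\<close> has at
  least 9n/20 - 27 neighbours in \<open>B\<close>, and \<open>x\<close> has at least half that
  number there, while \<open>B\<close> has at most 11n/20 + 27 vertices. So \<open>a\<close> and
  \<open>x\<close> share about n/8 neighbours in \<open>B\<close>, more than \<open>W\<close> can
  block.\<close>

lemma triangle_avoiding:
  assumes n: "3000 \<le> card V" and deg: "\<And>v. v \<in> V \<Longrightarrow> 9 * card V \<le> 20 * card (E `` {v})"
    and V: "V = S \<union> A \<union> B" "A \<inter> B = {}" and S: "card S \<le> 27"
    and indep: "E \<inter> A \<times> A = {}" "E \<inter> B \<times> B = {}"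
    and x: "27 < card (E `` {x} \<inter> A)" "card (E `` {x} \<inter> A) \<le> card (E `` {x} \<inter> B)"
    and W: "card W \<le> 27" "finite W" "x \<notin> W"
  shows "\<exists>T. is_triangle E T \<and> x \<in> T \<and> T \<inter> W = {}"
proof -
  let ?N = "\<lambda>v. E `` {v}"
  have finS: "finite S" "finite A" "finite B" using fin V by auto
  have "\<not> ?N x \<inter> A \<subseteq> W" using card_mono[of W "?N x \<inter> A"] W x by linarith
  then obtain a where a: "(x, a) \<in> E" "a \<in> A" "a \<notin> W" by blast
  \<comment> \<open>The neighbours of a vertex \<open>b\<close> of \<open>B\<close> lie in
    \<open>S\<close> and \<open>A\<close>; this bounds \<open>A\<close> from below and so
    \<open>B\<close> from above.\<close>
  have "?N x \<inter> B \<noteq> {}" using x by auto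
  then obtain b where b: "b \<in> B" by blast
  have Nx: "card (?N x) \<le> 27 + (card (?N x \<inter> A) + card (?N x \<inter> B))"
  proof -
    have "card (?N x) \<le> card (S \<union> (?N x \<inter> A \<union> ?N x \<inter> B))"
      using nbr_sub V finS by (intro card_mono) auto
    also have "\<dots> \<le> card S + (card (?N x \<inter> A) + card (?N x \<inter> B))"
      by (meson card_Un_le le_trans add_left_mono)
    finally show ?thesis using S by linarith
  qed
  have Na: "card (?N a) \<le> 27 + card (?N a \<inter> B)"
  proof -
    have "card (?N a) \<le> card (S \<union> ?N a \<inter> B)"
      using nbr_sub V finS indep a by (intro card_mono) auto
    also have "\<dots> \<le> card S + card (?N a \<inter> B)" by (rule card_Un_le)
    finally show ?thesis using S by linarith
  qed
  have Nb: "card (?N b) \<le> 27 + card A"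
  proof -
    have "card (?N b) \<le> card (S \<union> A)"
      using nbr_sub[of "{b}"] V finS indep b by (intro card_mono) blast+
    also have "\<dots> \<le> card S + card A" by (rule card_Un_le)
    finally show ?thesis using S by linarith
  qed
  have AB: "card A + card B \<le> card V"
    using card_Un_disjoint[of A B] card_mono[OF fin, of "A \<union> B"] V finS by auto
  have "card (?N a \<inter> B) + card (?N x \<inter> B) = card (?N a \<inter> B \<union> ?N x \<inter> B) + card (?N a \<inter> B \<inter> (?N x \<inter> B))"
    using finS by (intro card_Un_Int) auto
  moreover have "card (?N a \<inter> B \<union> ?N x \<inter> B) \<le> card B"
    using finS by (intro card_mono) auto
  moreover have "x \<in> V" "a \<in> V" "b \<in> V" using a b V edge_verts by auto
  ultimately have "27 < card (?N a \<inter> B \<inter> (?N x \<inter> B))"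
    using Nx Na Nb AB x n deg[of x] deg[of a] deg[of b] by linarith
  then have "\<not> ?N a \<inter> B \<inter> (?N x \<inter> B) \<subseteq> W"
    using card_mono[of W "?N a \<inter> B \<inter> (?N x \<inter> B)"] W by linarith
  then obtain c where "(a, c) \<in> E" "(x, c) \<in> E" "c \<notin> W" by blast
  then show ?thesis
    using triangle_insertI[of x a c] a W by (intro exI[of _ "{x, a, c}"]) auto
qed

text \<open>A triangle disjoint from a packing of greatest size could be added to it.\<close>

lemma packing_max:
  assumes "\<And>\<T>. packing E \<T> \<Longrightarrow> card \<T> < k"
  obtains \<T> where "packing E \<T>" "card \<T> < k" "\<And>T. is_triangle E T \<Longrightarrow> T \<inter> \<Union>\<T> \<noteq> {}"
proof -
  have "packing E {}" by (simp add: packing_def)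
  then obtain \<T> where \<T>: "packing E \<T>" "\<And>\<S>. packing E \<S> \<Longrightarrow> card \<S> \<le> card \<T>"
    using ex_has_greatest_nat[of "packing E" "{}" card k] assms by (metis less_imp_le)
  show ?thesis
  proof (rule that)
    fix T assume T: "is_triangle E T"
    show "T \<inter> \<Union>\<T> \<noteq> {}"
      using packing_insert[OF \<T>(1) T] \<T>(2)[of "insert T \<T>"] by fastforce
  qed (use \<T> assms in auto)
qed

text \<open>Outside the bounded set \<open>S \<union> P\<close>, a neighbourhood is determined by
  the side of the vertex and the trace on \<open>S \<union> P\<close>. The size 1485 is 27 for
  \<open>S\<close> plus 2 * 27 * 27 for \<open>P\<close>.\<close>

lemma card_nbr_image_le:
  assumes n: "3000 \<le> card V" and deg: "\<And>v. v \<in> V \<Longrightarrow> 9 * card V \<le> 20 * card (E `` {v})"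
    and free: "\<And>\<T>. packing E \<T> \<Longrightarrow> card \<T> \<noteq> 10"
    and maxl: "\<And>u v. u \<in> V \<Longrightarrow> v \<in> V \<Longrightarrow> u \<noteq> v \<Longrightarrow> (u, v) \<notin> E \<Longrightarrow>
      \<exists>\<T>. packing (E \<union> {(u, v), (v, u)}) \<T> \<and> card \<T> = 10"
  shows "card ((\<lambda>v. E `` {v}) ` V) \<le> 1485 + 2 * 2 ^ 1485"
proof -
  let ?N = "\<lambda>v. E `` {v}"
  have "card \<T> < 10" if "packing E \<T>" for \<T>
  proof (rule ccontr)
    assume "\<not> card \<T> < 10"
    then obtain \<S> where "\<S> \<subseteq> \<T>" "card \<S> = 10"
      by (metis not_less obtain_subset_with_card_n)
    then show False using packing_subset[OF that] free by blast
  qed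
  then obtain \<T> where \<T>: "packing E \<T>" "card \<T> < 10" "\<And>T. is_triangle E T \<Longrightarrow> T \<inter> \<Union>\<T> \<noteq> {}"
    using packing_max by blast
  define S where "S = \<Union>\<T>"
  have S: "finite S" "card S \<le> 27" "S \<subseteq> V"
    using \<T>(2) packing_card[OF \<T>(1)] packing_finite_Union[OF \<T>(1)] \<T>(1) triangle_subset_verts
    by (auto simp: S_def packing_def)
  define E0 where "E0 = E \<inter> (V - S) \<times> (V - S)"
  interpret E0: sgraph "V - S" E0
    using fin symE irr by unfold_locales (auto simp: E0_def sym_def irrefl_def)
  have "\<not> is_triangle E0 T" for T
  proof
    assume T: "is_triangle E0 T"
    then have "is_triangle E T" by (auto simp: is_triangle_def E0_def)
    with \<T>(3) E0.triangle_subset_verts[OF T] show False by (auto simp: S_def)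
  qed
  \<comment> \<open>Losing at most 27 neighbours keeps the degrees above 2n/5, since n/20 exceeds 27
    for n \<ge> 3000.\<close>
  moreover have "2 * card (V - S) < 5 * card (E0 `` {v})" if "v \<in> V - S" for v
  proof -
    have "E0 `` {v} = ?N v - S" using that edge_verts by (auto simp: E0_def)
    then have "card (?N v) - card S \<le> card (E0 `` {v})"
      using S by (simp add: diff_card_le_card_Diff)
    moreover have "card (V - S) \<le> card V" using fin by (intro card_mono) auto
    ultimately show ?thesis using deg[of v] n S that by simp
  qed
  ultimately obtain A B where AB: "A \<union> B = V - S" "A \<inter> B = {}" "E0 \<inter> A \<times> A = {}" "E0 \<inter> B \<times> B = {}"
    using E0.bipartite_if_triangle_free by metis
  have V: "V = S \<union> A \<union> B" "V = S \<union> B \<union> A" using AB S by auto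
  have indep: "E \<inter> A \<times> A = {}" "E \<inter> B \<times> B = {}" using AB by (auto simp: E0_def)
  \<comment> \<open>\<open>P\<close> collects, for each side, the neighbours there of those vertices
    of \<open>S\<close> that have at most 27 of them. The limit 27 is the number of vertices of nine
    disjoint triangles.\<close>
  define P where "P = (\<Union>s\<in>S. if card (?N s \<inter> A) \<le> 27 then ?N s \<inter> A else {})
    \<union> (\<Union>s\<in>S. if card (?N s \<inter> B) \<le> 27 then ?N s \<inter> B else {})"
  have "finite P" using S by (simp add: P_def)
  have poor: "card (\<Union>s\<in>S. if card (?N s \<inter> X) \<le> 27 then ?N s \<inter> X else {}) \<le> 729" for X
  proof -
    have "card (\<Union>s\<in>S. if card (?N s \<inter> X) \<le> 27 then ?N s \<inter> X else {})
      \<le> (\<Sum>s\<in>S. card (if card (?N s \<inter> X) \<le> 27 then ?N s \<inter> X else {}))"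
      by (rule card_UN_le) fact
    also have "\<dots> \<le> (\<Sum>s\<in>S. 27)" by (intro sum_mono) auto
    finally show ?thesis using S by simp
  qed
  have "card P \<le> 1458"
    unfolding P_def using poor[of A] poor[of B] by (intro order_trans[OF card_Un_le]) linarith
  then have SP: "card (S \<union> P) \<le> 1485"
    using card_Un_le[of S P] S by linarith
  \<comment> \<open>Adding a missing edge \<open>a b\<close> creates ten disjoint triangles, one of
    them through \<open>a\<close>, \<open>b\<close> and some \<open>x\<close>. This one can be
    exchanged for a triangle of \<open>E\<close> at \<open>x\<close> that avoids the other nine,
    contradicting \<open>free\<close>.\<close>
  have complete: "(a, b) \<in> E" if a: "a \<in> A - P" and b: "b \<in> B - P" for a b
  proof (rule ccontr)
    assume nE: "(a, b) \<notin> E"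
    have ab: "a \<in> V" "b \<in> V" "a \<noteq> b" using a b V AB by auto
    then obtain \<S> where \<S>: "packing (E \<union> {(a, b), (b, a)}) \<S>" "card \<S> = 10"
      using maxl nE by blast
    have "\<not> packing E \<S>" using free \<S> by blast
    then obtain T where T: "T \<in> \<S>" "\<not> is_triangle E T" "is_triangle (E \<union> {(a, b), (b, a)}) T"
      using \<S> by (auto simp: packing_def)
    have abT: "a \<in> T" "b \<in> T"
      using T by (auto simp: is_triangle_def)
    have "T \<noteq> {a, b}" using T \<open>a \<noteq> b\<close> by (auto simp: is_triangle_def)
    with abT obtain x where x: "x \<in> T" "x \<noteq> a" "x \<noteq> b" by blast
    with T abT have xE: "(x, a) \<in> E" "(x, b) \<in> E" by (auto simp: is_triangle_def)
    \<comment> \<open>Both sides are independent, and \<open>x\<close> has a neighbour in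
      each.\<close>
    have "x \<in> S"
      using edge_verts(1)[OF xE(1)] V indep xE a b by blast
    have rich: "27 < card (?N x \<inter> A)" "27 < card (?N x \<inter> B)"
    proof -
      show "27 < card (?N x \<inter> A)"
      proof (rule ccontr)
        assume "\<not> ?thesis"
        then have "a \<in> P" using a xE \<open>x \<in> S\<close> by (force simp: P_def)
        then show False using a by blast
      qed
      show "27 < card (?N x \<inter> B)"
      proof (rule ccontr)
        assume "\<not> ?thesis"
        then have "b \<in> P" using b xE \<open>x \<in> S\<close> by (force simp: P_def)
        then show False using b by blast
      qed
    qed
    have other: "T \<inter> T' = {}" if "T' \<in> \<S> - {T}" for T'
      using \<S> T that by (auto simp: packing_def pairwise_def disjnt_def)
    \<comment> \<open>The other triangles avoid \<open>a\<close> and \<open>b\<close>, so they do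
      not use the new edge.\<close>
    have "is_triangle E T'" if "T' \<in> \<S> - {T}" for T'
    proof -
      have "is_triangle (E \<union> {(a, b), (b, a)}) T'" using \<S> that by (simp add: packing_def)
      then show ?thesis using other[OF that] abT by (fastforce simp: is_triangle_def)
    qed
    then have pack: "packing E (\<S> - {T})"
      using \<S> by (auto simp: packing_def intro: pairwise_subset)
    let ?W = "\<Union>(\<S> - {T})"
    have cS: "card (\<S> - {T}) = 9" using \<S> T by (simp add: card_Diff_singleton)
    have W: "finite ?W" "card ?W \<le> 27" "x \<notin> ?W"
      using packing_finite_Union[OF pack] packing_card[OF pack] cS other x(1) by auto
    \<comment> \<open>\<open>triangle_avoiding\<close> expects the side with fewer neighbours of
      \<open>x\<close> first, so the second case exchanges \<open>A\<close> and
      \<open>B\<close>.\<close>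
    obtain T' where T': "is_triangle E T'" "T' \<inter> ?W = {}"
    proof (cases "card (?N x \<inter> A) \<le> card (?N x \<inter> B)")
      case True
      then show ?thesis
        using triangle_avoiding[OF n deg V(1) AB(2) S(2) indep rich(1) _ W(2,1,3)] that by blast
    next
      case False
      then have "card (?N x \<inter> B) \<le> card (?N x \<inter> A)" by simp
      then show ?thesis
        using triangle_avoiding[OF n deg V(2) _ S(2) indep(2,1) rich(2) _ W(2,1,3)] that AB(2) by blast
    qed
    show False
      using packing_insert[OF pack T'] free cS by simp
  qed
  have NA: "?N a = (B - P) \<union> (?N a \<inter> (S \<union> P))" if "a \<in> A - P" for a
    using complete[OF that] indep that edge_verts(2)[of a] V by blast
  have NB: "?N b = (A - P) \<union> (?N b \<inter> (S \<union> P))" if "b \<in> B - P" for b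
    using complete[OF _ that] indep that edge_verts(2)[of b] edge_sym V by blast
  let ?f = "\<lambda>X Y. (X - P) \<union> Y"
  have "?N ` V \<subseteq> ?N ` (S \<union> P) \<union> (?f A ` Pow (S \<union> P) \<union> ?f B ` Pow (S \<union> P))"
  proof
    fix X assume "X \<in> ?N ` V"
    then obtain v where v: "v \<in> V" "X = ?N v" by blast
    then consider "v \<in> S \<union> P" | "v \<in> A - P" | "v \<in> B - P" using V by blast
    then show "X \<in> ?N ` (S \<union> P) \<union> (?f A ` Pow (S \<union> P) \<union> ?f B ` Pow (S \<union> P))"
    proof cases
      case 2
      then have "X \<in> ?f B ` Pow (S \<union> P)" using NA v by blast
      then show ?thesis by blast
    next
      case 3
      then have "X \<in> ?f A ` Pow (S \<union> P)" using NB v by blast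
      then show ?thesis by blast
    qed (use v in blast)
  qed
  then have "card (?N ` V) \<le> card (?N ` (S \<union> P) \<union> (?f A ` Pow (S \<union> P) \<union> ?f B ` Pow (S \<union> P)))"
    using S \<open>finite P\<close> by (intro card_mono) auto
  also have "\<dots> \<le> card (?N ` (S \<union> P)) + (card (?f A ` Pow (S \<union> P)) + card (?f B ` Pow (S \<union> P)))"
    by (meson card_Un_le le_trans add_left_mono)
  also have "\<dots> \<le> card (S \<union> P) + (card (Pow (S \<union> P)) + card (Pow (S \<union> P)))"
    using S \<open>finite P\<close> by (intro add_mono card_image_le) auto
  also have "\<dots> = card (S \<union> P) + 2 * 2 ^ card (S \<union> P)"
    using S \<open>finite P\<close> by (simp add: card_Pow)
  also have "\<dots> \<le> 1485 + 2 * 2 ^ 1485"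
    using SP by (intro add_mono mult_left_mono power_increasing) auto
  finally show ?thesis .
qed

end

lemma blowup_admissible_H_tri: "blowup_admissible (H_tri 10) (9/20)"
proof -
  \<comment> \<open>The summand 3000 covers the graphs too small for the structural
    argument.\<close>
  define K :: nat where "K = 3000 + (1485 + 2 * 2 ^ 1485)"
  obtain F :: "nat pair_pre_digraph" where F: "pair_graph F"
    "\<And>G :: nat pair_pre_digraph. pair_graph G \<Longrightarrow> card ((\<lambda>v. parcs G `` {v}) ` pverts G) \<le> K \<Longrightarrow> is_blowup G F"
    using universal_blowup by metis
  have "is_blowup G F"
    if G: "pair_graph G" and mf: "maximal_free (H_tri 10) G"
      and deg: "real (min_degree G) \<ge> 9/20 * real (card (pverts G))" for G :: "nat pair_pre_digraph"
  proof (rule F(2)[OF G], cases "3000 \<le> card (pverts G)")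
    case False
    interpret sgraph "pverts G" "parcs G" using G by (simp add: pair_graph_iff_sgraph)
    have "card ((\<lambda>v. parcs G `` {v}) ` pverts G) \<le> card (pverts G)"
      using fin by (rule card_image_le)
    with False show "card ((\<lambda>v. parcs G `` {v}) ` pverts G) \<le> K"
      unfolding K_def by linarith
  next
    case True
    interpret sgraph "pverts G" "parcs G" using G by (simp add: pair_graph_iff_sgraph)
    have deg': "9 * card (pverts G) \<le> 20 * card (parcs G `` {v})" if "v \<in> pverts G" for v
      using min_degree_le[OF G that] deg by linarith
    have "card ((\<lambda>v. parcs G `` {v}) ` pverts G) \<le> 1485 + 2 * 2 ^ 1485"
    proof (rule card_nbr_image_le[OF True deg'])
      fix \<T> assume "packing (parcs G) \<T>"
      then show "card \<T> \<noteq> 10"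
        using embeds_H_tri_of_packing[OF True deg'] mf contains_copy_iff[OF G pair_graph_H_tri]
        by (auto simp: maximal_free_def)
    next
      fix u v assume uv: "u \<in> pverts G" "v \<in> pverts G" "u \<noteq> v" "(u, v) \<notin> parcs G"
      then have "contains_copy (add_edge G u v) (H_tri 10)"
        using mf by (auto simp: maximal_free_def)
      moreover have "pair_graph (add_edge G u v)"
        using sgraph_insert[OF uv(1-3)] by (simp add: pair_graph_iff_sgraph)
      ultimately obtain f where "embeds (H_tri 10) (parcs G \<union> {(u, v), (v, u)}) (pverts G) f"
        using contains_copy_iff[OF _ pair_graph_H_tri] by (metis add_edge_simps)
      then show "\<exists>\<T>. packing (parcs G \<union> {(u, v), (v, u)}) \<T> \<and> card \<T> = 10"
        by (rule packing_of_embeds)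
    qed
    then show "card ((\<lambda>v. parcs G `` {v}) ` pverts G) \<le> K"
      unfolding K_def by linarith
  qed
  with F(1) show ?thesis unfolding blowup_admissible_def by blast
qed

section \<open>The lower bound\<close>

text \<open>There are finitely many \<open>H\<close>-free edge sets on these vertices that contain
  the given one; one that is maximal under inclusion works.\<close>

lemma maximal_free_extension:
  fixes H :: "'b pair_pre_digraph" and G\<^sub>0 :: "'a pair_pre_digraph"
  assumes H: "pair_graph H" and G\<^sub>0: "pair_graph G\<^sub>0" "\<not> contains_copy G\<^sub>0 H"
  obtains G where "pair_graph G" "maximal_free H G" "pverts G = pverts G\<^sub>0" "parcs G\<^sub>0 \<subseteq> parcs G"
proof -
  let ?V = "pverts G\<^sub>0"
  let ?G = "\<lambda>E. \<lparr>pverts = ?V, parcs = E\<rparr>"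
  define X where "X = {E. sgraph ?V E \<and> parcs G\<^sub>0 \<subseteq> E \<and> \<not> contains_copy (?G E) H}"
  interpret G\<^sub>0: sgraph ?V "parcs G\<^sub>0" using G\<^sub>0 by (simp add: pair_graph_iff_sgraph)
  have "finite X"
    by (rule finite_subset[of _ "Pow (?V \<times> ?V)"]) (use G\<^sub>0.fin sgraph.sub in \<open>auto simp: X_def\<close>)
  moreover have "parcs G\<^sub>0 \<in> X"
    using G\<^sub>0 G\<^sub>0.sgraph_axioms by (cases "G\<^sub>0") (simp add: X_def)
  ultimately obtain E where E: "E \<in> X" "\<And>E'. E' \<in> X \<Longrightarrow> E \<subseteq> E' \<Longrightarrow> E' = E"
    using finite_has_maximal2[of X "parcs G\<^sub>0"] by metis
  interpret sgraph ?V E using E by (simp add: X_def)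
  show ?thesis
  proof (rule that[of "?G E"])
    show "maximal_free H (?G E)"
      unfolding maximal_free_def
    proof (intro conjI ballI impI)
      show "\<not> contains_copy (?G E) H" using E by (simp add: X_def)
      fix u v assume "u \<in> pverts (?G E)" "v \<in> pverts (?G E)" "u \<noteq> v \<and> (u, v) \<notin> parcs (?G E)"
      then have uv: "u \<in> ?V" "v \<in> ?V" "u \<noteq> v" "(u, v) \<notin> E" by auto
      have "E \<union> {(u, v), (v, u)} \<notin> X" using E(2)[of "E \<union> {(u, v), (v, u)}"] uv by blast
      then show "contains_copy (add_edge (?G E) u v) H"
        using E(1) sgraph_insert[OF uv(1-3)] by (auto simp: X_def add_edge_def)
    qed
  qed (use E sgraph_axioms in \<open>auto simp: X_def pair_graph_iff_sgraph\<close>)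
qed

text \<open>
  \<open>A\<close> and \<open>B\<close> are the two large sides; each edge between them is present, so the degrees are close to
  half the order. If \<open>Al i\<close> and \<open>Al j\<close> became twins, both would be adjacent to the ends of the edges
  from \<open>S\<close> to \<open>B 0\<close> and from \<open>T\<close> to \<open>Be i\<close>, which is a copy of \<open>H_tri 2\<close>.
\<close>

datatype base_vertex = S | T | Al nat | Be nat | A nat | B nat

instance base_vertex :: countable by countable_datatype

fun base_arc :: "base_vertex \<Rightarrow> base_vertex \<Rightarrow> bool" where
  "base_arc S (Al i) = True"
| "base_arc S (B i) = True"
| "base_arc T (A i) = True"
| "base_arc T (Al i) = True"
| "base_arc T (Be i) = True"
| "base_arc (A i) (B j) = True"
| "base_arc (A i) (Be j) = True"
| "base_arc (Al i) (B j) = True"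
| "base_arc (Al i) (Be j) = (i = j)"
| "base_arc _ _ = False"

definition base_adj :: "base_vertex \<Rightarrow> base_vertex \<Rightarrow> bool" where
  "base_adj x y \<longleftrightarrow> base_arc x y \<or> base_arc y x"

text \<open>Forgets the indices, leaving only the six classes of vertices to compare.\<close>

fun side :: "base_vertex \<Rightarrow> nat" where
  "side S = 0" | "side T = 1" | "side (Al i) = 2" | "side (Be i) = 3" | "side (A i) = 4" | "side (B i) = 5"

text \<open>Without \<open>S\<close> and \<open>T\<close> the graph is bipartite, and an edge
  avoiding both has at most one of them as a common neighbour. The edges at \<open>S\<close> and
  those at \<open>T\<close> have common neighbours in different combinations of classes.\<close>

lemma base_adj_common_nbrs:
  assumes "base_adj a b" "base_adj p a" "base_adj p b" "base_adj q a" "base_adj q b" "p \<noteq> q"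
  shows "S \<in> {a, b} \<and> {side p, side q} \<in> {{2}, {5}} \<or>
    T \<in> {a, b} \<and> {side p, side q} \<in> {{3}, {4}, {2, 4}}"
  using assms(1)
  apply (cases a; cases b; simp add: base_adj_def)
  using assms(2-)
  by (cases p; simp add: base_adj_def; cases q; auto)+

text \<open>Each of the two disjoint edges contains \<open>S\<close> or \<open>T\<close>, so one
  contains \<open>S\<close> and the other \<open>T\<close>; but the classes of \<open>p\<close> and
  \<open>q\<close> allow only one of these.\<close>

lemma base_adj_no_2K2_join:
  assumes "base_adj a b" "base_adj c d" "\<And>x. x \<in> {a, b, c, d} \<Longrightarrow> base_adj p x \<and> base_adj q x"
    and "distinct [p, a, b, q, c, d]"
  shows False
proof -
  have "{a, b} \<inter> {c, d} = {}" "p \<noteq> q" using assms(4) by auto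
  define X where "X = {side p, side q}"
  have X: "X \<notin> {{3}, {4}, {2, 4}}" if "X \<in> {{2}, {5}}"
    using that by auto
  have "S \<in> {a, b} \<and> X \<in> {{2}, {5}} \<or> T \<in> {a, b} \<and> X \<in> {{3}, {4}, {2, 4}}"
    using base_adj_common_nbrs[OF assms(1)] assms(3) \<open>p \<noteq> q\<close> unfolding X_def by (metis insertCI)
  moreover have "S \<in> {c, d} \<and> X \<in> {{2}, {5}} \<or> T \<in> {c, d} \<and> X \<in> {{3}, {4}, {2, 4}}"
    using base_adj_common_nbrs[OF assms(2)] assms(3) \<open>p \<noteq> q\<close> unfolding X_def by (metis insertCI)
  ultimately show False using X \<open>{a, b} \<inter> {c, d} = {}\<close> by blast
qed

section \<open>Order, degrees and \<open>H_tri 2\<close>-freeness of the base graph\<close>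

definition base_verts :: "nat \<Rightarrow> nat \<Rightarrow> base_vertex set" where
  "base_verts k m = {S, T} \<union> Al ` {..<k} \<union> Be ` {..<k} \<union> A ` {..<m} \<union> B ` {..<m}"

text \<open>Moved to natural numbers, since \<open>blowup_admissible\<close> ranges over such
  graphs.\<close>

definition base :: "nat \<Rightarrow> nat \<Rightarrow> nat pair_pre_digraph" where
  "base k m = \<lparr>pverts = to_nat ` base_verts k m,
     parcs = {(to_nat x, to_nat y) |x y. x \<in> base_verts k m \<and> y \<in> base_verts k m \<and> base_adj x y}\<rparr>"

lemma arc_base [simp]:
  "(to_nat x, to_nat y) \<in> parcs (base k m) \<longleftrightarrow> x \<in> base_verts k m \<and> y \<in> base_verts k m \<and> base_adj x y"
  by (auto simp: base_def)

lemma finite_base_verts: "finite (base_verts k m)"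
  by (simp add: base_verts_def)

lemma pair_graph_base: "pair_graph (base k m)"
proof -
  have "base_adj x y \<longleftrightarrow> base_adj y x" "\<not> base_adj x x" for x y
    by (cases x; auto simp: base_adj_def)+
  then show ?thesis
    unfolding pair_graph_iff_sgraph using finite_base_verts
    by unfold_locales (auto simp: base_def sym_def irrefl_def)
qed

lemma card_base: "card (pverts (base k m)) \<le> 2 + 2 * k + 2 * m"
proof -
  have "card (base_verts k m) \<le> card {S, T} + card (Al ` {..<k}) + card (Be ` {..<k}) + card (A ` {..<m}) + card (B ` {..<m})"
    unfolding base_verts_def by (intro order_trans[OF card_Un_le] add_mono order_refl)
  also have "\<dots> = 2 + 2 * k + 2 * m"
    by (simp add: card_image inj_on_def)
  finally show ?thesis
    using card_image_le[OF finite_base_verts, of to_nat k m] by (simp add: base_def)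
qed

text \<open>Every vertex is adjacent to all the vertices \<open>A j\<close> or to all the vertices
  \<open>B j\<close>.\<close>

lemma degree_base:
  assumes "v \<in> pverts (base k m)"
  shows "m \<le> card (parcs (base k m) `` {v})"
proof -
  obtain x where x: "x \<in> base_verts k m" "v = to_nat x" using assms by (auto simp: base_def)
  have sub: "A ` {..<m} \<subseteq> base_verts k m" "B ` {..<m} \<subseteq> base_verts k m"
    by (auto simp: base_verts_def)
  have fin: "finite (parcs (base k m) `` {v})"
    by (rule finite_subset[of _ "pverts (base k m)"]) (auto simp: base_def finite_base_verts)
  consider "\<forall>j. base_adj x (A j)" | "\<forall>j. base_adj x (B j)" by (cases x) (auto simp: base_adj_def)
  then obtain C :: "nat \<Rightarrow> base_vertex" where C: "inj C" "to_nat ` C ` {..<m} \<subseteq> parcs (base k m) `` {v}"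
  proof cases
    case 1
    then show ?thesis using x sub by (intro that[of A]) (auto simp: inj_def)
  next
    case 2
    then show ?thesis using x sub by (intro that[of B]) (auto simp: inj_def)
  qed
  have "card (to_nat ` C ` {..<m}) = m"
    using C(1) by (simp add: card_image inj_on_def inj_def image_image)
  with card_mono[OF fin C(2)] show ?thesis by simp
qed

lemma base_free: "\<not> contains_copy (base k m) (H_tri 2)"
proof
  assume "contains_copy (base k m) (H_tri 2)"
  then obtain f where emb: "embeds (H_tri 2) (parcs (base k m)) (pverts (base k m)) f"
    using contains_copy_iff[OF pair_graph_base pair_graph_H_tri] by blast
  have "pverts (H_tri 2) = {..<6}" "pverts (base k m) = to_nat ` base_verts k m"
    by (auto simp: H_tri_def base_def)
  with emb have inj: "inj_on f {..<6}" and sub: "f ` {..<6} \<subseteq> to_nat ` base_verts k m"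
    and arc: "\<And>u v. (u, v) \<in> parcs (H_tri 2) \<Longrightarrow> (f u, f v) \<in> parcs (base k m)"
    by (simp_all add: embeds_def)
  define g :: "nat \<Rightarrow> base_vertex" where "g u = from_nat (f u)" for u
  have f: "f u = to_nat (g u)" if "u < 6" for u
    using sub that by (force simp: g_def)
  have adj: "base_adj (g u) (g v)" if "(u, v) \<in> parcs (H_tri 2)" for u v
  proof -
    have "u < 6" "v < 6" using that by (auto simp: H_tri_def)
    then show ?thesis using arc[OF that] by (simp add: f)
  qed
  have "inj_on g {..<6}"
    using inj f by (auto simp: inj_on_def)
  then have dist: "distinct [g 0, g 1, g 2, g 3, g 4, g 5]"
    by (simp add: inj_on_eq_iff)
  \<comment> \<open>Vertices 0 and 3 act as \<open>p\<close> and \<open>q\<close>, and 12 and 45 as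
    the two disjoint edges.\<close>
  have edge: "base_adj (g u) (g v)"
    if "(u, v) \<in> {(1, 2), (4, 5), (0, 1), (0, 2), (0, 4), (0, 5), (3, 1), (3, 2), (3, 4), (3, 5)}" for u v
    using that by (intro adj) (auto simp: H_tri_def H_glue_def)
  show False
  proof (rule base_adj_no_2K2_join[OF edge edge _ dist])
    fix x assume "x \<in> {g 1, g 2, g 4, g 5}"
    then obtain v where "v \<in> {1, 2, 4, 5}" "x = g v" by blast
    then show "base_adj (g 0) x \<and> base_adj (g 3) x" using edge[of 0 v] edge[of 3 v] by auto
  qed simp_all
qed

text \<open>For \<alpha> below 1/2 and \<open>m\<close> large, a maximal extension of
  \<open>base k m\<close> has enough minimum degree to be a blowup of \<open>F\<close>. With
  \<open>k\<close> above the number of parts, two of the vertices \<open>Al i\<close> are twins,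
  which creates a forbidden copy.\<close>

lemma half_le_if_admissible:
  assumes "blowup_admissible (H_tri 2) \<alpha>" "0 \<le> \<alpha>"
  shows "1 / 2 \<le> \<alpha>"
proof (rule ccontr)
  assume "\<not> 1 / 2 \<le> \<alpha>"
  then have pos: "0 < 1 - 2 * \<alpha>" by simp
  obtain F :: "nat pair_pre_digraph" where F: "pair_graph F"
    "\<And>G :: nat pair_pre_digraph. pair_graph G \<Longrightarrow> maximal_free (H_tri 2) G \<Longrightarrow>
       \<alpha> * real (card (pverts G)) \<le> real (min_degree G) \<Longrightarrow> is_blowup G F"
    using assms by (auto simp: blowup_admissible_def)
  define k where "k = Suc (card (pverts F))"
  \<comment> \<open>The bound is \<alpha> (2 + 2k + 2m) \<le> m solved for m; its left side is at
    least \<alpha> times the order of the graph.\<close>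
  obtain m0 :: nat where m0: "\<alpha> * (2 + 2 * real k) / (1 - 2 * \<alpha>) \<le> real m0"
    using real_arch_simple by blast
  \<comment> \<open>The successor makes \<open>m\<close> positive, so that the vertex
    \<open>B 0\<close> exists.\<close>
  define m where "m = Suc m0"
  have "\<alpha> * (2 + 2 * real k) \<le> real m * (1 - 2 * \<alpha>)"
    using m0 pos by (simp add: m_def pos_divide_le_eq algebra_simps)
  then have m: "\<alpha> * (2 + 2 * real k + 2 * real m) \<le> real m"
    by (simp add: algebra_simps)
  obtain G where G: "pair_graph G" "maximal_free (H_tri 2) G" "pverts G = pverts (base k m)"
    "parcs (base k m) \<subseteq> parcs G"
    using maximal_free_extension[OF pair_graph_H_tri pair_graph_base base_free] by blast
  interpret sgraph "pverts G" "parcs G" using G by (simp add: pair_graph_iff_sgraph)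
  have "m \<le> min_degree G"
  proof (rule min_degree_ge[OF G(1)])
    show "pverts G \<noteq> {}" by (simp add: G(3)) (simp add: base_def base_verts_def)
    fix v assume "v \<in> pverts G"
    then have "m \<le> card (parcs (base k m) `` {v})" using G(3) degree_base by simp
    also have "\<dots> \<le> card (parcs G `` {v})" using G(4) by (intro card_mono) auto
    finally show "m \<le> card (parcs G `` {v})" .
  qed
  moreover have "\<alpha> * real (card (pverts G)) \<le> \<alpha> * (2 + 2 * real k + 2 * real m)"
    using card_base[of k m] assms(2) by (intro mult_left_mono) (simp_all add: G(3))
  ultimately have "is_blowup G F"
    using F(2)[OF G(1,2)] m by linarith
  moreover have "card (to_nat ` Al ` {..<k}) = k"
    by (simp add: card_image inj_on_def image_image)
  ultimately have "\<exists>u\<in>to_nat ` Al ` {..<k}. \<exists>v\<in>to_nat ` Al ` {..<k}. u \<noteq> v \<and> parcs G `` {u} = parcs G `` {v}"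
    using F(1) by (intro blowup_twins) (auto simp: k_def G(3), auto simp: base_def base_verts_def)
  then obtain i j where ij: "i < k" "j < k" "i \<noteq> j" "parcs G `` {to_nat (Al i)} = parcs G `` {to_nat (Al j)}"
    by auto
  have E: "(to_nat x, to_nat y) \<in> parcs G" if "x \<in> base_verts k m" "y \<in> base_verts k m" "base_adj x y" for x y
    using G(4) that arc_base by blast
  have V: "S \<in> base_verts k m" "T \<in> base_verts k m" "Al i \<in> base_verts k m" "Al j \<in> base_verts k m"
    "Be i \<in> base_verts k m" "B 0 \<in> base_verts k m"
    using ij by (auto simp: base_verts_def m_def)
  have "(to_nat (Al i), to_nat (Be i)) \<in> parcs G"
    using V by (intro E) (auto simp: base_adj_def)
  then have "(to_nat (Al j), to_nat (Be i)) \<in> parcs G" using ij(4) by blast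
  \<comment> \<open>The packing is empty; \<open>Al i\<close> and \<open>Al j\<close> take the roles
    of 0 and 3. All required edges come from the base graph except the one from \<open>Al j\<close>
    to \<open>Be i\<close>, which the twins provide.\<close>
  then have "\<exists>f. embeds (H_tri (0 + 2)) (parcs G) (pverts G) f"
    using V ij(3)
    by (intro embeds_H_tri[of "{}" 0 "to_nat (Al i)" "to_nat S" "to_nat (B 0)" "to_nat (Al j)" "to_nat T" "to_nat (Be i)"])
      (auto simp: packing_def base_adj_def intro!: E)
  then have "contains_copy G (H_tri 2)"
    using contains_copy_iff[OF G(1) pair_graph_H_tri] by (simp only: add_0)
  then show False
    using G(2) by (simp add: maximal_free_def)
qed

theorem theorem1p2:
  shows "\<exists>H1 H2 :: nat pair_pre_digraph.
           pair_graph H1 \<and> pair_graph H2 \<and>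
           induced_subgraph (with_proj H1) (with_proj H2) \<and>
           blowup_threshold H1 > blowup_threshold H2"
proof (intro exI conjI)
  have "blowup_threshold (H_tri 10) \<le> 9 / 20"
    unfolding blowup_threshold_def
    using blowup_admissible_H_tri blowup_threshold_set(2) by (intro cInf_lower) auto
  moreover have "1 / 2 \<le> blowup_threshold (H_tri 2)"
    unfolding blowup_threshold_def
    using half_le_if_admissible blowup_threshold_set(1) by (intro cInf_greatest) auto
  ultimately show "blowup_threshold (H_tri 2) > blowup_threshold (H_tri 10)"
    by linarith
qed (simp_all add: pair_graph_H_tri induced_subgraph_H_tri)

end
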